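(* Let $n$ be a positive integer and let $S, T \subseteq [n]$ with $|S|=|T|$. Then $$\sum_{P \in P_n(S,T)} y^{\mathrm{pmaj}(P)}=\sum_{P \in P_n(S,T)} y^{\mathrm{cr}_2(P)}.$$ That is, the two statistics $\mathrm{cr}_2$ and $\mathrm{pmaj}$ have the same distribution over each set $P_n(S,T)$.
   Context: $[n]=\{1,2,\dots,n\}$, and $\Pi_n$ is the set of all set partitions of $[n]$. For $P\in\Pi_n$, the standard representation of $P$ is the graph on vertex set $[n]$ whose edges (arcs) are the pairs $(i,j)$, $i<j$, such that $i$ and $j$ are consecutive elements (in numerical order) of the same block of $P$; $i$ is the left-hand endpoint and $j$ the right-hand endpoint of the arc $(i,j)$. $\min(P)$ (resp. $\max(P)$) is the set of minimal (resp. maximal) elements of the blocks of $P$, and $P_n(S,T)=\{P\in\Pi_n:\min(P)=S,\ \max(P)=T\}$ (possibly empty). Two arcs $(i_1,j_1),(i_2,j_2)$ form a 2-crossing if $i_1<i_2<j_1<j_2$; $\mathrm{cr}_2(P)$ is the number of 2-crossings of the standard representation of $P$. For a word $w=a_1a_2\cdots a_t$ of integers, $\mathrm{des}(w)$ is the number of indices $1\le i<t$ with $a_i>a_{i+1}$. The p-major index $\mathrm{pmaj}(P)$ is defined as follows. Let the arcs of $P$ be $(i_1,j_1),\dots,(i_k,j_k)$ with $i_1>i_2>\cdots>i_k$, and give the arc $(i_r,j_r)$ the label $r$. Let $r_1>r_2>\cdots>r_k$ be the right-hand endpoints of the arcs. Words $\sigma(r_1),\dots,\sigma(r_k)$ are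 defined recursively: $\sigma(r_1)$ is the one-letter word $a$, where $a$ is the label of the arc with right-hand endpoint $r_1$; and $\sigma(r_{i+1})$ is obtained from $\sigma(r_i)$ by deleting the labels of all arcs whose left-hand endpoint $\ell$ satisfies $r_{i+1}\le \ell<r_i$, and then adding at the very beginning the letter $b$, the label of the arc with right-hand endpoint $r_{i+1}$. Then $\mathrm{pmaj}(P)=\sum_{i=1}^k\mathrm{des}(\sigma(r_i))$ (equal to $0$ if $P$ has no arcs). Here $y$ is an indeterminate. *)

theory Defs
  imports "HOL-Library.Disjoint_Sets" "HOL-Computational_Algebra.Polynomial"
begin

definition arcs :: "nat set set \<Rightarrow> (nat \<times> nat) set" where
  "arcs P = {(i, j). i < j \<and> (\<exists>B\<in>P. i \<in> B \<and> j \<in> B \<and> \<not> (\<exists>k\<in>B. i < k \<and> k < j))}"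

definition partitions_min_max :: "nat \<Rightarrow> nat set \<Rightarrow> nat set \<Rightarrow> nat set set set" where
  "partitions_min_max n S T = {P. partition_on {1..n} P \<and> Min ` P = S \<and> Max ` P = T}"

(* The condition i1 < i2 orders the two arcs, so each 2-crossing is counted once. *)
definition cr2 :: "nat set set \<Rightarrow> nat" where
  "cr2 P = card {((i1, j1), (i2, j2)).
     (i1, j1) \<in> arcs P \<and> (i2, j2) \<in> arcs P \<and> i1 < i2 \<and> i2 < j1 \<and> j1 < j2}"

definition des :: "nat list \<Rightarrow> nat" where
  "des w = card {i. Suc i < length w \<and> w ! i > w ! Suc i}"

(* For a set partition P of [n] with k arcs, no two arcs share a left-hand endpoint and no
   two share a right-hand endpoint.  So left_end P r = i_r with i_1 > ... > i_k,
   right_end P r = r_r with r_1 > ... > r_k (indices 1, ..., k), and left_end P a is the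
   left-hand endpoint of the arc labelled a. *)
definition left_end :: "nat set set \<Rightarrow> nat \<Rightarrow> nat" where
  "left_end P r = rev (sorted_list_of_set (fst ` arcs P)) ! (r - 1)"

definition right_end :: "nat set set \<Rightarrow> nat \<Rightarrow> nat" where
  "right_end P r = rev (sorted_list_of_set (snd ` arcs P)) ! (r - 1)"

(* The label of the arc with right-hand endpoint j. *)
definition label_at :: "nat set set \<Rightarrow> nat \<Rightarrow> nat" where
  "label_at P j = (THE a. a \<in> {1..card (arcs P)} \<and> (left_end P a, j) \<in> arcs P)"

(* sigma P i is the word attached to the right-hand endpoint right_end P i, for 1 <= i <= k;
   the value at 0 is a dummy. *)
fun sigma :: "nat set set \<Rightarrow> nat \<Rightarrow> nat list" where
  "sigma P 0 = []"
| "sigma P (Suc 0) = [label_at P (right_end P 1)]"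
| "sigma P (Suc (Suc i)) =
     label_at P (right_end P (Suc (Suc i))) #
     filter (\<lambda>a. \<not> (right_end P (Suc (Suc i)) \<le> left_end P a \<and> left_end P a < right_end P (Suc i)))
       (sigma P (Suc i))"

definition pmaj :: "nat set set \<Rightarrow> nat" where
  "pmaj P = (\<Sum>i = 1..card (arcs P). des (sigma P i))"

end

theory Submission
  imports Defs
begin

text \<open>
  Fixing the minima \<open>S\<close> and maxima \<open>T\<close> of the blocks fixes the right endpoints \<open>[n] - S\<close> and the
  left endpoints \<open>[n] - T\<close> of the arcs, and a partition amounts to a matching of right endpoints with
  smaller left endpoints. List the right endpoints as \<open>rs\<close> in decreasing order and record the
  matching as the word \<open>x\<close> of the corresponding left endpoints, so that \<open>x ! i < rs ! i\<close>. Both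
  statistics can be read off \<open>x\<close>: \<open>pmaj\<close> adds up the descents of the prefixes \<open>x ! 0, \<dots>, x ! i\<close>, each
  restricted to letters below \<open>rs ! i\<close>, and \<open>cr2\<close> counts the pairs of an earlier letter \<open>l\<close> and a later
  letter \<open>x ! p\<close> with \<open>x ! p < l < rs ! p\<close>.

  Now induct on the number of arcs by removing the largest left endpoint \<open>m\<close>, together with the
  largest right endpoint. If exactly \<open>t\<close> right endpoints exceed \<open>m\<close>, then \<open>m\<close> may be reinserted into a
  smaller word at exactly the positions \<open>0, \<dots>, t - 1\<close> (\<open>arc_words_insert_max_bij\<close>), and both
  generating functions get multiplied by \<open>1 + y + \<dots> + y\<^sup>t\<^sup>-\<^sup>1\<close>. For crossings this is immediate:
  insertion at position \<open>j\<close> adds \<open>t - 1 - j\<close> crossings (\<open>word_cr_insert_max\<close>). For \<open>pmaj\<close>, the first \<open>t\<close>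
  prefixes are not affected by the restriction, and it removes \<open>m\<close> from all later ones; so the change
  of \<open>pmaj\<close> is the change of the sum of prefix descents, a variant of the major index, of an ordinary
  word when a new maximum is inserted (\<open>word_pmaj_insert_max\<close>). By the classical insertion property of
  the major index these changes are \<open>0, \<dots>, t - 1\<close> in some order (\<open>sum_prefix_des_insert_max\<close>).
\<close>

section \<open>Inserting a new maximum into a word\<close>

lemma des_snoc: "des (w @ [c]) = des w + (if w \<noteq> [] \<and> last w > c then 1 else 0)"
proof -
  have lw: "w ! i = last w" if "i < length w" "\<not> Suc i < length w" for i
  proof -
    have "i = length w - 1" "w \<noteq> []" using that by auto
    then show ?thesis by (simp add: last_conv_nth)
  qed
  have "{i. Suc i < length (w @ [c]) \<and> (w @ [c]) ! i > (w @ [c]) ! Suc i} =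
    {i. Suc i < length w \<and> w ! i > w ! Suc i} \<union>
    (if w \<noteq> [] \<and> last w > c then {length w - 1} else {})"
    by (auto simp: nth_append lw)
  moreover have "finite {i. Suc i < length w \<and> w ! i > w ! Suc i}"
    by (rule finite_subset[of _ "{..<length w}"]) auto
  ultimately show ?thesis
    unfolding des_def by (subst card_Un_disjoint | simp)+
qed

lemma des_Nil [simp]: "des [] = 0"
  by (simp add: des_def)

text \<open>
  A descent \<open>u ! i > u ! Suc i\<close> is contained in \<open>length u - Suc i\<close> prefixes, so this is the major index
  with positions of descents counted from the right end.
\<close>

definition prefix_des :: "nat list \<Rightarrow> nat" where
  "prefix_des u = (\<Sum>i<length u. des (take (Suc i) u))"

lemma prefix_des_snoc: "prefix_des (u @ [c]) = prefix_des u + des (u @ [c])"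
  by (simp add: prefix_des_def)

definition insert_at :: "nat \<Rightarrow> 'a \<Rightarrow> 'a list \<Rightarrow> 'a list" where
  "insert_at j m u = take j u @ m # drop j u"

lemma length_insert_at [simp]: "length (insert_at j m u) = Suc (length u)"
  by (simp add: insert_at_def)

lemma set_insert_at [simp]: "set (insert_at j m u) = insert m (set u)"
  unfolding insert_at_def by (metis append_take_drop_id list.simps(15) set_append Un_insert_right)

lemma distinct_insert_at [simp]:
  "distinct (insert_at j m u) \<longleftrightarrow> m \<notin> set u \<and> distinct u"
proof -
  have "distinct (insert_at j m u) \<longleftrightarrow> distinct (m # take j u @ drop j u)"
    unfolding insert_at_def by (auto simp del: append_take_drop_id)
  then show ?thesis by simp
qed

lemma take_insert_at:
  "j \<le> i \<Longrightarrow> i \<le> length u \<Longrightarrow> take (Suc i) (insert_at j m u) = insert_at j m (take i u)"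
  by (simp add: insert_at_def take_Cons' drop_take min_def Suc_diff_le)

lemma nth_insert_at:
  "j \<le> length u \<Longrightarrow> insert_at j m u ! p = (if p < j then u ! p else if p = j then m else u ! (p - 1))"
  by (cases p) (auto simp: insert_at_def nth_append nth_Cons' min_def)

lemma insert_at_snoc:
  "j \<le> length v \<Longrightarrow> insert_at j m (v @ [c]) = insert_at j m v @ [c]"
  by (simp add: insert_at_def)

lemma insert_at_length: "insert_at (length u) m u = u @ [m]"
  by (simp add: insert_at_def)

lemma filter_insert_at_False: "\<not> Q m \<Longrightarrow> filter Q (insert_at j m u) = filter Q u"
  unfolding insert_at_def by (metis append_take_drop_id filter.simps(2) filter_append)

lemma filter_insert_at_True: "Q m \<Longrightarrow> length (filter Q (insert_at j m u)) = Suc (length (filter Q u))"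
proof -
  assume "Q m"
  then have "length (filter Q (insert_at j m u)) = Suc (length (filter Q (take j u @ drop j u)))"
    unfolding insert_at_def filter_append by simp
  then show ?thesis by simp
qed

text \<open>
  Inserting a new maximum at one of the first \<open>length u\<close> positions either splits a descent of \<open>u\<close>,
  which keeps the number of descents, or creates a new one; the identity says that the former
  insertions raise \<open>prefix_des\<close> by \<open>0, \<dots>, des u - 1\<close> and the latter by \<open>des u + 1, \<dots>, length u\<close>. The
  missing value \<open>des u\<close> belongs to the insertion at the end.

  The variable \<open>z\<close> makes the induction work: appending a letter to a word adds its new number of
  descents to \<open>prefix_des\<close>, which amounts to substituting \<open>z * y\<close> for \<open>z\<close>. The bound on \<open>des u\<close> is
  carried along because it is needed to split the second range of exponents.
\<close>

lemma sum_des_prefix_des_insert_max: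
  fixes y z :: "'a::comm_semiring_1"
  assumes "\<And>l. l \<in> set u \<Longrightarrow> l < m"
  shows "(\<Sum>j<length u. z ^ des (insert_at j m u) * y ^ prefix_des (insert_at j m u)) =
    z ^ des u * y ^ prefix_des u * ((\<Sum>i<des u. y ^ i) + z * (\<Sum>i=Suc (des u)..length u. y ^ i))
    \<and> des u \<le> length u"
  using assms
proof (induction u arbitrary: z rule: rev_induct)
  case Nil
  then show ?case by simp
next
  case (snoc c v)
  define d where "d = des v"
  define e :: nat where "e = (if v \<noteq> [] \<and> last v > c then 1 else 0)"
  have dn: "d \<le> length v" using snoc.IH[of 1] snoc.prems by (simp add: d_def)
  have du: "des (v @ [c]) = d + e" by (simp add: des_snoc d_def e_def)
  have cm: "c < m" using snoc.prems by simp
  \<comment> \<open>Insertions before the end of \<open>v\<close> do not change its last letter, hence commute with appending \<open>c\<close>.\<close>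
  have old: "z ^ des (insert_at j m (v @ [c])) * y ^ prefix_des (insert_at j m (v @ [c])) =
      (z * y) ^ e * ((z * y) ^ des (insert_at j m v) * y ^ prefix_des (insert_at j m v))"
    if "j < length v" for j
  proof -
    have "last (insert_at j m v) = last v" "insert_at j m v \<noteq> []" "v \<noteq> []"
      using that by (auto simp: insert_at_def)
    then have "des (insert_at j m (v @ [c])) = des (insert_at j m v) + e"
      using that by (simp add: insert_at_snoc des_snoc e_def)
    then show ?thesis
      using that by (simp add: insert_at_snoc prefix_des_snoc power_add power_mult_distrib ac_simps)
  qed
  \<comment> \<open>Insertion between \<open>v\<close> and \<open>c\<close> supplies the exponent missing from the shifted ranges: the top of
     the first range if \<open>v\<close> ends above \<open>c\<close>, and the bottom of the second one otherwise.\<close>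
  have lastw: "insert_at (length v) m (v @ [c]) = (v @ [m]) @ [c]"
    by (simp add: insert_at_def)
  have dm: "des (v @ [m]) = d"
    using snoc.prems[of "last v"] by (auto simp: des_snoc d_def)
  have new: "z ^ des (insert_at (length v) m (v @ [c])) * y ^ prefix_des (insert_at (length v) m (v @ [c])) =
      z ^ Suc d * y ^ (prefix_des v + d + Suc d)"
    unfolding lastw prefix_des_snoc des_snoc[of "v @ [m]"] dm using cm by simp
  have "(\<Sum>j<length (v @ [c]). z ^ des (insert_at j m (v @ [c])) * y ^ prefix_des (insert_at j m (v @ [c])))
    = (z * y) ^ e * (\<Sum>j<length v. (z * y) ^ des (insert_at j m v) * y ^ prefix_des (insert_at j m v))
      + z ^ Suc d * y ^ (prefix_des v + d + Suc d)"
    using old by (simp add: new sum_distrib_left del: power_Suc)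
  also have "(\<Sum>j<length v. (z * y) ^ des (insert_at j m v) * y ^ prefix_des (insert_at j m v)) =
     (z * y) ^ d * y ^ prefix_des v * ((\<Sum>i<d. y ^ i) + z * y * (\<Sum>i=Suc d..length v. y ^ i))"
    using snoc.IH[of "z * y"] snoc.prems by (simp add: d_def)
  also have "z * y * (\<Sum>i=Suc d..length v. y ^ i) = z * (\<Sum>i=Suc (Suc d)..Suc (length v). y ^ i)"
    by (simp add: sum.shift_bounds_cl_Suc_ivl sum_distrib_left ac_simps del: sum.cl_ivl_Suc)
  also have "(z * y) ^ e * ((z * y) ^ d * y ^ prefix_des v *
        ((\<Sum>i<d. y ^ i) + z * (\<Sum>i=Suc (Suc d)..Suc (length v). y ^ i)))
      + z ^ Suc d * y ^ (prefix_des v + d + Suc d) =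
     z ^ (d + e) * y ^ (prefix_des v + d + e) *
       ((\<Sum>i<d + e. y ^ i) + z * (\<Sum>i=Suc (d + e)..Suc (length v). y ^ i))"
  proof (cases "e = 0")
    case True
    have "(\<Sum>i=Suc d..Suc (length v). y ^ i) = y ^ Suc d + (\<Sum>i=Suc (Suc d)..Suc (length v). y ^ i)"
      using dn by (subst sum.atLeast_Suc_atMost) auto
    then show ?thesis using True
      by (simp add: algebra_simps power_add power_mult_distrib del: sum.cl_ivl_Suc)
  next
    case False
    then have "e = 1" by (simp add: e_def split: if_splits)
    then show ?thesis
      by (simp add: algebra_simps power_add power_mult_distrib del: sum.cl_ivl_Suc)
  qed
  finally show ?case
    using dn du by (simp add: prefix_des_snoc e_def ac_simps del: sum.cl_ivl_Suc)
qed

text \<open>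
  Setting \<open>z = 1\<close> and adding the insertion at the end, which raises \<open>prefix_des\<close> by \<open>des u\<close>, fills the
  gap between the two ranges of exponents.
\<close>

lemma sum_prefix_des_insert_max:
  fixes y :: "'a::comm_semiring_1"
  assumes "\<And>l. l \<in> set u \<Longrightarrow> l < m"
  shows "(\<Sum>j\<le>length u. y ^ prefix_des (insert_at j m u)) = y ^ prefix_des u * (\<Sum>i\<le>length u. y ^ i)"
proof -
  define d where "d = des u"
  note * = sum_des_prefix_des_insert_max[of u m 1 y, OF assms, simplified]
  have d: "d \<le> length u" using * by (simp add: d_def)
  have "des (u @ [m]) = d"
    using assms[of "last u"] by (auto simp: des_snoc d_def)
  then have "(\<Sum>j\<le>length u. y ^ prefix_des (insert_at j m u)) =
     y ^ prefix_des u * ((\<Sum>i<d. y ^ i) + (\<Sum>i=Suc d..length u. y ^ i)) + y ^ (prefix_des u + d)"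
    using * by (simp add: insert_at_length prefix_des_snoc d_def flip: lessThan_Suc_atMost)
  also have "\<dots> = y ^ prefix_des u * ((\<Sum>i<Suc d. y ^ i) + (\<Sum>i=Suc d..length u. y ^ i))"
    by (simp add: algebra_simps power_add)
  also have "(\<Sum>i<Suc d. y ^ i) + (\<Sum>i=Suc d..length u. y ^ i) = (\<Sum>i\<in>{..<Suc d} \<union> {Suc d..length u}. y ^ i)"
    by (rule sum.union_disjoint[symmetric]) auto
  also have "{..<Suc d} \<union> {Suc d..length u} = {..length u}"
    using d by auto
  finally show ?thesis .
qed

section \<open>Arc words and their two statistics\<close>

text \<open>
  The matchings of the right endpoints \<open>rs\<close> with the left endpoints \<open>ls\<close>; \<open>x ! i\<close> is the left endpoint
  of the arc that ends in \<open>rs ! i\<close>. Below, \<open>rs\<close> is always decreasing, so reading \<open>x\<close> from left to right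
  scans the right endpoints from right to left.
\<close>

definition arc_words :: "nat list \<Rightarrow> nat list \<Rightarrow> nat list set" where
  "arc_words ls rs = {x. distinct x \<and> set x = set ls \<and> length x = length rs \<and> (\<forall>i<length rs. x ! i < rs ! i)}"

definition word_pmaj :: "nat list \<Rightarrow> nat list \<Rightarrow> nat" where
  "word_pmaj rs x = (\<Sum>i<length x. des (filter (\<lambda>l. l < rs ! i) (take (Suc i) x)))"

definition word_cr :: "nat list \<Rightarrow> nat list \<Rightarrow> nat" where
  "word_cr rs x = (\<Sum>p<length x. length (filter (\<lambda>l. x ! p < l \<and> l < rs ! p) (take p x)))"

text \<open>
  In the next three lemmas \<open>N + 1\<close> is the number of right endpoints above the new largest left
  endpoint \<open>m\<close>. The right endpoint added along with \<open>m\<close> is the largest one, \<open>r\<close>. The letters behind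
  \<open>m\<close> keep their right endpoints, and those before \<open>m\<close> all move up to the next larger one, which keeps
  their right endpoints above \<open>m\<close> and thus above all letters.
\<close>

text \<open>
  The summands \<open>0, \<dots>, N\<close> see all letters, so they add up to \<open>prefix_des\<close> of the prefix; the later ones
  ignore \<open>m\<close> and agree with those of the smaller word, shifted by one.
\<close>

lemma word_pmaj_insert_max:
  assumes len: "length x = length rs" and max: "\<And>l. l \<in> set x \<Longrightarrow> l < m"
    and big: "\<And>i. i \<le> N \<Longrightarrow> m < (r # rs) ! i"
    and small: "\<And>i. N < i \<Longrightarrow> i \<le> length rs \<Longrightarrow> (r # rs) ! i \<le> m"
    and N: "N \<le> length rs" and j: "j \<le> N"
  shows "word_pmaj (r # rs) (insert_at j m x) =
      (word_pmaj rs x - prefix_des (take N x)) + prefix_des (insert_at j m (take N x))"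
    and "prefix_des (take N x) \<le> word_pmaj rs x"
proof -
  let ?k = "length rs"
  \<comment> \<open>The part of \<open>word_pmaj\<close> that is common to both words.\<close>
  define tail where "tail = (\<Sum>i=N..<?k. des (filter (\<lambda>l. l < rs ! i) (take (Suc i) x)))"
  have old: "word_pmaj rs x = prefix_des (take N x) + tail"
  proof -
    have "word_pmaj rs x = (\<Sum>i<N. des (filter (\<lambda>l. l < rs ! i) (take (Suc i) x))) + tail"
      unfolding word_pmaj_def len tail_def lessThan_atLeast0 using N by (simp add: sum.atLeastLessThan_concat)
    also have "(\<Sum>i<N. des (filter (\<lambda>l. l < rs ! i) (take (Suc i) x))) = prefix_des (take N x)"
    proof -
      have "filter (\<lambda>l. l < rs ! i) (take (Suc i) x) = take (Suc i) (take N x)" if "i < N" for i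
      proof -
        have "m < rs ! i" using big[of "Suc i"] that by simp
        then have "filter (\<lambda>l. l < rs ! i) (take (Suc i) x) = take (Suc i) x"
          using max by (auto simp: filter_id_conv dest!: in_set_takeD) (meson less_trans)
        then show ?thesis using that by (simp add: min_def)
      qed
      then show ?thesis using N len by (simp add: prefix_des_def)
    qed
    finally show ?thesis .
  qed
  have new: "word_pmaj (r # rs) (insert_at j m x) = prefix_des (insert_at j m (take N x)) + tail"
  proof -
    let ?x = "insert_at j m x"
    let ?f = "\<lambda>i. des (filter (\<lambda>l. l < (r # rs) ! i) (take (Suc i) ?x))"
    have "word_pmaj (r # rs) ?x = sum ?f {0..<Suc ?k}"
      by (simp add: word_pmaj_def len atLeast0LessThan)
    also have "\<dots> = sum ?f {0..<Suc N} + sum ?f {Suc N..<Suc ?k}"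
      using N by (intro sum.atLeastLessThan_concat[symmetric]) auto
    also have "sum ?f {Suc N..<Suc ?k} = (\<Sum>i=N..<?k. ?f (Suc i))"
      by (rule sum.shift_bounds_Suc_ivl)
    also have "\<dots> = tail"
      unfolding tail_def
    proof (rule sum.cong[OF refl])
      fix i assume i: "i \<in> {N..<?k}"
      have "take (Suc (Suc i)) ?x = insert_at j m (take (Suc i) x)"
        using i j len by (intro take_insert_at) auto
      moreover have "\<not> m < (r # rs) ! Suc i" using small[of "Suc i"] i by simp
      ultimately show "?f (Suc i) = des (filter (\<lambda>l. l < rs ! i) (take (Suc i) x))"
        by (simp add: filter_insert_at_False)
    qed
    also have "sum ?f {0..<Suc N} = prefix_des (insert_at j m (take N x))"
    proof -
      have "filter (\<lambda>l. l < (r # rs) ! i) (take (Suc i) ?x) = take (Suc i) (insert_at j m (take N x))"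
        if "i < Suc N" for i
      proof -
        have "m < (r # rs) ! i" using big[of i] that by simp
        then have "\<And>l. l \<in> set ?x \<Longrightarrow> l < (r # rs) ! i"
          using max by (auto intro: less_trans)
        then have "filter (\<lambda>l. l < (r # rs) ! i) (take (Suc i) ?x) = take (Suc i) ?x"
          by (auto simp: filter_id_conv dest!: in_set_takeD)
        also have "\<dots> = take (Suc i) (take (Suc N) ?x)" using that by (simp add: min_def)
        also have "take (Suc N) ?x = insert_at j m (take N x)"
          using j N len by (intro take_insert_at) auto
        finally show ?thesis .
      qed
      then show ?thesis using N len by (simp add: prefix_des_def atLeast0LessThan del: sum.lessThan_Suc)
    qed
    finally show ?thesis .
  qed
  show "word_pmaj (r # rs) (insert_at j m x) =
      (word_pmaj rs x - prefix_des (take N x)) + prefix_des (insert_at j m (take N x))"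
    using old new by simp
  show "prefix_des (take N x) \<le> word_pmaj rs x" using old by simp
qed

text \<open>
  The arc of \<open>m\<close> is the right-hand arc of the crossings it takes part in, since its left endpoint is
  the largest; it crosses exactly the \<open>N - j\<close> arcs whose right endpoints lie between \<open>m\<close> and its own.
\<close>

lemma word_cr_insert_max:
  assumes len: "length x = length rs" and max: "\<And>l. l \<in> set x \<Longrightarrow> l < m"
    and big: "\<And>i. i \<le> N \<Longrightarrow> m < (r # rs) ! i"
    and small: "\<And>i. N < i \<Longrightarrow> i \<le> length rs \<Longrightarrow> (r # rs) ! i \<le> m"
    and N: "N \<le> length rs" and j: "j \<le> N"
  shows "word_cr (r # rs) (insert_at j m x) = word_cr rs x + (N - j)"
proof -
  let ?k = "length rs" and ?x = "insert_at j m x"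
  let ?f = "\<lambda>p. length (filter (\<lambda>l. ?x ! p < l \<and> l < (r # rs) ! p) (take p ?x))"
  let ?g = "\<lambda>p. length (filter (\<lambda>l. x ! p < l \<and> l < rs ! p) (take p x))"
  have jl: "j \<le> length x" using j N len by simp
  have nth: "\<And>p. ?x ! p = (if p < j then x ! p else if p = j then m else x ! (p - 1))"
    using jl by (rule nth_insert_at)
  have lo: "?f p = ?g p" if "p < j" for p
  proof -
    have t: "take p ?x = take p x" using that jl by (simp add: insert_at_def min_def)
    have "m < (r # rs) ! p" "m < rs ! p" using big[of p] big[of "Suc p"] that j by auto
    then have "filter (\<lambda>l. x ! p < l \<and> l < (r # rs) ! p) (take p x) =
        filter (\<lambda>l. x ! p < l \<and> l < rs ! p) (take p x)"
      using max by (intro filter_cong refl) (auto dest!: in_set_takeD intro: less_trans)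
    then show ?thesis using that by (simp add: t nth)
  qed
  have mid: "?f j = 0"
  proof -
    have "take j ?x = take j x" using jl by (simp add: insert_at_def min_def)
    then show ?thesis using max by (auto simp: nth filter_empty_conv dest!: in_set_takeD) (meson less_asym)
  qed
  have hi: "?f (Suc p) = ?g p + (if p < N then 1 else 0)" if "j \<le> p" "p < ?k" for p
  proof -
    have t: "take (Suc p) ?x = insert_at j m (take p x)"
      using that len by (intro take_insert_at) auto
    have n: "?x ! Suc p = x ! p" using that by (simp add: nth)
    have lt: "x ! p < m" using that len max by simp
    show ?thesis
    proof (cases "p < N")
      case True
      then have "m < rs ! p" using big[of "Suc p"] by simp
      then show ?thesis using True lt by (simp add: t n filter_insert_at_True)
    next
      case False
      then have "\<not> m < rs ! p" using small[of "Suc p"] that by simp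
      then show ?thesis using False lt by (simp add: t n filter_insert_at_False)
    qed
  qed
  have "word_cr (r # rs) ?x = sum ?f {0..<Suc ?k}"
    by (simp add: word_cr_def len atLeast0LessThan)
  also have "\<dots> = sum ?f {0..<j} + sum ?f {j..<Suc ?k}"
    using j N by (intro sum.atLeastLessThan_concat[symmetric]) auto
  also have "sum ?f {j..<Suc ?k} = sum ?f {Suc j..<Suc ?k}"
    using j N mid by (subst sum.atLeast_Suc_lessThan) auto
  also have "\<dots> = (\<Sum>p=j..<?k. ?f (Suc p))"
    by (rule sum.shift_bounds_Suc_ivl)
  also have "\<dots> = (\<Sum>p=j..<?k. ?g p + (if p < N then 1 else 0))"
    using hi by (intro sum.cong) auto
  also have "\<dots> = sum ?g {j..<?k} + (\<Sum>p=j..<?k. if p < N then 1 else 0)"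
    by (rule sum.distrib)
  also have "(\<Sum>p=j..<?k. if p < N then 1 else 0 :: nat) = card {p \<in> {j..<?k}. p < N}"
    by (simp add: sum.If_cases Int_def)
  also have "{p \<in> {j..<?k}. p < N} = {j..<N}" using N by auto
  also have "sum ?f {0..<j} = sum ?g {0..<j}" using lo by (intro sum.cong) auto
  also have "sum ?g {0..<j} + (sum ?g {j..<?k} + card {j..<N}) = sum ?g {0..<?k} + (N - j)"
    using j N by (simp add: sum.atLeastLessThan_concat flip: add.assoc)
  also have "sum ?g {0..<?k} = word_cr rs x" by (simp add: word_cr_def len atLeast0LessThan)
  finally show ?thesis .
qed

lemma arc_words_insert_max_bij:
  assumes max: "\<And>l. l \<in> set ls \<Longrightarrow> l < m"
    and big: "\<And>i. i \<le> N \<Longrightarrow> m < (r # rs) ! i"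
    and small: "\<And>i. N < i \<Longrightarrow> i \<le> length rs \<Longrightarrow> (r # rs) ! i \<le> m"
    and N: "N \<le> length rs"
  shows "bij_betw (\<lambda>(x, j). insert_at j m x) (arc_words ls rs \<times> {..N}) (arc_words (m # ls) (r # rs))"
proof (rule bij_betw_imageI)
  have mem: "m \<notin> set x" "length x = length rs" if "x \<in> arc_words ls rs" for x
    using that max by (auto simp: arc_words_def)
  show "inj_on (\<lambda>(x, j). insert_at j m x) (arc_words ls rs \<times> {..N})"
  proof (rule inj_onI, clarify)
    fix x j x' j'
    assume x: "x \<in> arc_words ls rs" and x': "x' \<in> arc_words ls rs" and jj: "j \<le> N" "j' \<le> N"
      and eq: "insert_at j m x = insert_at j' m x'"
    have "take j x = take j' x' \<and> drop j x = drop j' x'"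
      using eq mem[OF x] mem[OF x'] unfolding insert_at_def
      by (subst (asm) append_Cons_eq_iff) (auto dest: in_set_takeD in_set_dropD)
    moreover from this have "j = j'"
      using mem[OF x] mem[OF x'] jj N by (metis length_take min.absorb2 le_trans)
    ultimately show "x = x' \<and> j = j'" by (metis append_take_drop_id)
  qed
  show "(\<lambda>(x, j). insert_at j m x) ` (arc_words ls rs \<times> {..N}) = arc_words (m # ls) (r # rs)"
  proof (intro equalityI subsetI)
    fix w assume "w \<in> (\<lambda>(x, j). insert_at j m x) ` (arc_words ls rs \<times> {..N})"
    then obtain x j where w: "w = insert_at j m x" and x: "x \<in> arc_words ls rs" and j: "j \<le> N" by auto
    have "w ! i < (r # rs) ! i" if "i \<le> length rs" for i
    proof -
      have len: "j \<le> length x" using mem[OF x] j N by simp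
      consider "i < j" | "i = j" | "j < i" by linarith
      then show ?thesis
      proof cases
        case 1
        then have "x ! i \<in> set x" using len by simp
        then have "x ! i < m" using max x by (auto simp: arc_words_def)
        with 1 show ?thesis using big[of i] j by (simp add: w nth_insert_at[OF len])
      next
        case 2
        then show ?thesis using big[of i] j by (simp add: w nth_insert_at[OF len])
      next
        case 3
        then show ?thesis using x that
          by (cases i) (auto simp: w nth_insert_at[OF len] arc_words_def)
      qed
    qed
    then show "w \<in> arc_words (m # ls) (r # rs)"
      using x mem[OF x] by (auto simp: w arc_words_def less_Suc_eq_le)
  next
    fix w assume w: "w \<in> arc_words (m # ls) (r # rs)"
    then have "m \<in> set w" by (auto simp: arc_words_def)
    then obtain a b where ab: "w = a @ m # b" by (auto simp: in_set_conv_decomp)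
    let ?x = "a @ b" and ?j = "length a"
    have wi: "w = insert_at ?j m ?x" by (simp add: ab insert_at_def)
    have lw: "length w = Suc (length rs)" and lt: "\<And>i. i \<le> length rs \<Longrightarrow> w ! i < (r # rs) ! i"
      using w by (auto simp: arc_words_def)
    have j: "?j \<le> N"
    proof (rule ccontr)
      assume "\<not> ?j \<le> N"
      then have "(r # rs) ! ?j \<le> m" using small[of ?j] lw ab by simp
      moreover have "m < (r # rs) ! ?j" using lt[of ?j] lw by (simp add: ab)
      ultimately show False by simp
    qed
    have sx: "set ?x = set ls" and dx: "distinct ?x"
    proof -
      have "m \<notin> set ls" using max by blast
      moreover have "m \<notin> set ?x" "insert m (set ?x) = insert m (set ls)" "distinct ?x"
        using w by (auto simp: arc_words_def ab)
      ultimately show "set ?x = set ls" "distinct ?x" by (metis insert_ident)+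
    qed
    have "?x ! i < rs ! i" if i: "i < length rs" for i
    proof (cases "i < ?j")
      case True
      then have "a ! i \<in> set ?x" by simp
      then have "a ! i < m" using max sx by blast
      then show ?thesis using True big[of "Suc i"] j by (simp add: nth_append)
    next
      case False
      then have "?x ! i = w ! Suc i" by (simp add: ab nth_append Suc_diff_le)
      then show ?thesis using lt[of "Suc i"] i by simp
    qed
    then have "?x \<in> arc_words ls rs" using sx dx lw by (auto simp: arc_words_def ab)
    then show "w \<in> (\<lambda>(x, j). insert_at j m x) ` (arc_words ls rs \<times> {..N})"
      using wi j by (intro image_eqI[of _ _ "(?x, ?j)"]) auto
  qed
qed

text \<open>
  Adding the largest left endpoint multiplies either side by the same polynomial
  \<open>1 + y + \<dots> + y\<^sup>N\<close>, where \<open>N + 1\<close> right endpoints lie above it; if there are none, both sums are empty.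
\<close>

lemma sum_word_pmaj_eq_sum_word_cr:
  fixes y :: "'a::comm_semiring_1"
  assumes "sorted_wrt (>) ls" and "sorted_wrt (>) rs" and "length ls = length rs"
  shows "(\<Sum>x\<in>arc_words ls rs. y ^ word_pmaj rs x) = (\<Sum>x\<in>arc_words ls rs. y ^ word_cr rs x)"
  using assms
proof (induction ls arbitrary: rs)
  case Nil
  then show ?case by (intro sum.cong) (auto simp: arc_words_def word_pmaj_def word_cr_def)
next
  case (Cons m ls rs0)
  then obtain r rs where rs0: "rs0 = r # rs" by (cases rs0) auto
  have len: "length ls = length rs" and max: "\<And>l. l \<in> set ls \<Longrightarrow> l < m"
    using Cons.prems by (auto simp: rs0)
  have desc: "(r # rs) ! i' \<le> (r # rs) ! i" if "i \<le> i'" "i' \<le> length rs" for i i'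
    using sorted_wrt_nth_less[OF Cons.prems(2)[unfolded rs0], of i i'] that
    by (cases "i = i'") auto
  show ?case
  proof (cases "m < r")
    case False
    have "arc_words (m # ls) (r # rs) = {}"
    proof (rule ccontr)
      assume "arc_words (m # ls) (r # rs) \<noteq> {}"
      then obtain w where w: "w \<in> arc_words (m # ls) (r # rs)" by auto
      then have "m \<in> set w" by (auto simp: arc_words_def)
      then obtain i where "i < length w" "w ! i = m" by (auto simp: in_set_conv_nth)
      then have "m < (r # rs) ! i" "i \<le> length rs" using w by (auto simp: arc_words_def)
      then show False using desc[of 0 i] False by simp
    qed
    then show ?thesis by (simp add: rs0)
  next
    case True
    \<comment> \<open>Since \<open>r # rs\<close> decreases, the right endpoints above \<open>m\<close> are those at positions up to \<open>N\<close>.\<close>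
    define N where "N = Max {i. i \<le> length rs \<and> m < (r # rs) ! i}"
    have fin: "finite {i. i \<le> length rs \<and> m < (r # rs) ! i}" by simp
    have ne: "{i. i \<le> length rs \<and> m < (r # rs) ! i} \<noteq> {}" using True by auto
    have NN: "N \<le> length rs" "m < (r # rs) ! N" using Max_in[OF fin ne] by (auto simp: N_def)
    have big: "m < (r # rs) ! i" if "i \<le> N" for i
      using desc[OF that NN(1)] NN(2) by simp
    have small: "(r # rs) ! i \<le> m" if "N < i" "i \<le> length rs" for i
      using Max_ge[OF fin, of i] that unfolding N_def[symmetric] by force
    note bij = arc_words_insert_max_bij[OF max big small NN(1)]
    have reindex: "(\<Sum>w\<in>arc_words (m # ls) (r # rs). y ^ F w) =
      (\<Sum>x\<in>arc_words ls rs. \<Sum>j\<le>N. y ^ F (insert_at j m x))" for F :: "nat list \<Rightarrow> nat"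
      by (simp add: sum.cartesian_product split_def flip: sum.reindex_bij_betw[OF bij])
    have x: "length x = length rs" "\<And>l. l \<in> set x \<Longrightarrow> l < m" if "x \<in> arc_words ls rs" for x
      using that max by (auto simp: arc_words_def)
    have "(\<Sum>j\<le>N. y ^ word_pmaj (r # rs) (insert_at j m x)) = y ^ word_pmaj rs x * (\<Sum>i\<le>N. y ^ i)"
      if xw: "x \<in> arc_words ls rs" for x
    proof -
      define u where "u = take N x"
      have u: "length u = N" "\<And>l. l \<in> set u \<Longrightarrow> l < m"
        using x[OF xw] NN by (auto simp: u_def dest: in_set_takeD)
      have le: "prefix_des u \<le> word_pmaj rs x"
        using word_pmaj_insert_max(2)[OF x[OF xw] big small NN(1) order_refl] by (simp add: u_def)
      have "(\<Sum>j\<le>N. y ^ word_pmaj (r # rs) (insert_at j m x)) =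
        y ^ (word_pmaj rs x - prefix_des u) * (\<Sum>j\<le>N. y ^ prefix_des (insert_at j m u))"
        using word_pmaj_insert_max(1)[OF x[OF xw] big small NN(1)]
        by (simp add: u_def sum_distrib_left power_add)
      also have "(\<Sum>j\<le>N. y ^ prefix_des (insert_at j m u)) = y ^ prefix_des u * (\<Sum>i\<le>N. y ^ i)"
        using sum_prefix_des_insert_max[of u m y, OF u(2)] by (simp add: u(1))
      finally show ?thesis using le by (simp flip: mult.assoc power_add)
    qed
    moreover have "(\<Sum>j\<le>N. y ^ word_cr (r # rs) (insert_at j m x)) = y ^ word_cr rs x * (\<Sum>i\<le>N. y ^ i)"
      if xw: "x \<in> arc_words ls rs" for x
    proof -
      have "(\<Sum>j\<le>N. y ^ word_cr (r # rs) (insert_at j m x)) = (\<Sum>j\<le>N. y ^ word_cr rs x * y ^ (N - j))"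
        using word_cr_insert_max[OF x[OF xw] big small NN(1)] by (simp flip: power_add)
      also have "\<dots> = y ^ word_cr rs x * (\<Sum>j\<le>N. y ^ (N - j))"
        by (simp add: sum_distrib_left)
      also have "(\<Sum>j\<le>N. y ^ (N - j)) = (\<Sum>i\<le>N. y ^ i)"
        by (rule sum.reindex_bij_witness[of _ "\<lambda>i. N - i" "\<lambda>i. N - i"]) auto
      finally show ?thesis .
    qed
    moreover have "(\<Sum>x\<in>arc_words ls rs. y ^ word_pmaj rs x) = (\<Sum>x\<in>arc_words ls rs. y ^ word_cr rs x)"
      using Cons.IH[of rs] Cons.prems by (simp add: rs0)
    ultimately show ?thesis
      by (simp add: rs0 reindex flip: sum_distrib_right)
  qed
qed

section \<open>Partitions and systems of arcs\<close>

lemma arcs_less: "(i, j) \<in> arcs P \<Longrightarrow> i < j"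
  by (simp add: arcs_def)

lemma arcs_same_block:
  assumes "partition_on A P" "B \<in> P" "(i, j) \<in> arcs P"
  shows "i \<in> B \<longleftrightarrow> j \<in> B"
  using assms unfolding arcs_def partition_on_def disjoint_def by blast

lemma arcsI: "B \<in> P \<Longrightarrow> i \<in> B \<Longrightarrow> j \<in> B \<Longrightarrow> i < j \<Longrightarrow> (\<And>k. k \<in> B \<Longrightarrow> i < k \<Longrightarrow> j \<le> k) \<Longrightarrow> (i, j) \<in> arcs P"
  unfolding arcs_def by (auto simp: not_less[symmetric])

lemma single_valued_arcs:
  assumes "partition_on A P"
  shows "single_valued (arcs P)" "single_valued ((arcs P)\<inverse>)"
proof -
  show "single_valued (arcs P)"
  proof (rule single_valuedI)
    fix i j k assume a: "(i, j) \<in> arcs P" "(i, k) \<in> arcs P"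
    obtain B where B: "B \<in> P" "i \<in> B" "j \<in> B" "\<not> (\<exists>l\<in>B. i < l \<and> l < j)" using a(1) by (auto simp: arcs_def)
    obtain B' where B': "B' \<in> P" "i \<in> B'" "k \<in> B'" "\<not> (\<exists>l\<in>B'. i < l \<and> l < k)" using a(2) by (auto simp: arcs_def)
    have "B = B'" using assms B B' unfolding partition_on_def disjoint_def by blast
    then show "j = k" using B B' arcs_less[OF a(1)] arcs_less[OF a(2)] by (meson linorder_neqE_nat)
  qed
  show "single_valued ((arcs P)\<inverse>)"
  proof (rule single_valuedI, simp)
    fix i j k assume a: "(j, i) \<in> arcs P" "(k, i) \<in> arcs P"
    obtain B where B: "B \<in> P" "i \<in> B" "j \<in> B" "\<not> (\<exists>l\<in>B. j < l \<and> l < i)" using a(1) by (auto simp: arcs_def)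
    obtain B' where B': "B' \<in> P" "i \<in> B'" "k \<in> B'" "\<not> (\<exists>l\<in>B'. k < l \<and> l < i)" using a(2) by (auto simp: arcs_def)
    have "B = B'" using assms B B' unfolding partition_on_def disjoint_def by blast
    then show "j = k" using B B' arcs_less[OF a(1)] arcs_less[OF a(2)] by (meson linorder_neqE_nat)
  qed
qed

lemma ex_arc_into:
  assumes "B \<in> P" "finite B" "j \<in> B" "j \<noteq> Min B"
  shows "\<exists>i\<in>B. (i, j) \<in> arcs P"
proof -
  let ?C = "{i\<in>B. i < j}"
  have "Min B \<le> j" "Min B \<in> B" using assms by (auto intro: Min_in)
  then have "Min B \<in> ?C" using assms(4) by simp
  then have C: "finite ?C" "?C \<noteq> {}" using assms(2) by auto
  have "(Max ?C, j) \<in> arcs P"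
    using Max_in[OF C] Max_ge[OF C(1)] assms by (intro arcsI[of B]) (auto simp: not_less[symmetric])
  then show ?thesis using Max_in[OF C] by blast
qed

lemma ex_arc_from:
  assumes "B \<in> P" "finite B" "i \<in> B" "i \<noteq> Max B"
  shows "\<exists>j\<in>B. (i, j) \<in> arcs P"
proof -
  let ?C = "{j\<in>B. i < j}"
  have "i \<le> Max B" "Max B \<in> B" using assms by (auto intro: Max_in)
  then have "Max B \<in> ?C" using assms(4) by simp
  then have C: "finite ?C" "?C \<noteq> {}" using assms(2) by auto
  have "(i, Min ?C) \<in> arcs P"
    using Min_in[OF C] Min_le[OF C(1)] assms by (intro arcsI[of B]) auto
  then show ?thesis using Min_in[OF C] by blast
qed

lemma finite_block: "partition_on A P \<Longrightarrow> finite A \<Longrightarrow> B \<in> P \<Longrightarrow> finite B \<and> B \<noteq> {} \<and> B \<subseteq> A"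
  unfolding partition_on_def by (auto intro: finite_subset)

lemma Domain_Range_arcs:
  assumes P: "partition_on A P" "finite A"
  shows "Domain (arcs P) = A - Max ` P" "Range (arcs P) = A - Min ` P"
proof -
  have un: "A = \<Union>P" using P by (simp add: partition_on_def)
  note fb = finite_block[OF P]
  show "Domain (arcs P) = A - Max ` P"
  proof (intro equalityI subsetI)
    fix i assume "i \<in> Domain (arcs P)"
    then obtain j where j: "(i, j) \<in> arcs P" by auto
    have "i \<noteq> Max B" if B: "B \<in> P" for B
    proof
      assume i: "i = Max B"
      then have "i \<in> B" using fb[OF B] by simp
      then have "j \<in> B" using arcs_same_block[OF P(1) B j] by simp
      then have "j \<le> Max B" using fb[OF B] Max_ge by blast
      then show False using i arcs_less[OF j] by linarith
    qed
    moreover have "i \<in> A" using j un by (auto simp: arcs_def)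
    ultimately show "i \<in> A - Max ` P" by auto
  next
    fix i assume i: "i \<in> A - Max ` P"
    then obtain B where "B \<in> P" "i \<in> B" using un by auto
    then show "i \<in> Domain (arcs P)" using ex_arc_from[of B P i] fb i by blast
  qed
  show "Range (arcs P) = A - Min ` P"
  proof (intro equalityI subsetI)
    fix j assume "j \<in> Range (arcs P)"
    then obtain i where i: "(i, j) \<in> arcs P" by auto
    have "j \<noteq> Min B" if B: "B \<in> P" for B
    proof
      assume j: "j = Min B"
      then have "j \<in> B" using fb[OF B] by simp
      then have "i \<in> B" using arcs_same_block[OF P(1) B i] by simp
      then have "Min B \<le> i" using fb[OF B] Min_le by blast
      then show False using j arcs_less[OF i] by linarith
    qed
    moreover have "j \<in> A" using i un by (auto simp: arcs_def)
    ultimately show "j \<in> A - Min ` P" by auto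
  next
    fix j assume j: "j \<in> A - Min ` P"
    then obtain B where "B \<in> P" "j \<in> B" using un by auto
    then show "j \<in> Range (arcs P)" using ex_arc_into[of B P j] fb j by blast
  qed
qed

text \<open>
  The inverse of \<open>arcs\<close>: the blocks are the chains of arcs, each traced from its starting point.
\<close>

definition chain_partition :: "('a \<times> 'a) set \<Rightarrow> 'a set \<Rightarrow> 'a set set" where
  "chain_partition E S = (\<lambda>s. E\<^sup>* `` {s}) ` S"

lemma block_eq_chain:
  assumes P: "partition_on A P" "finite A" and B: "B \<in> P"
  shows "B = (arcs P)\<^sup>* `` {Min B}"
proof (intro equalityI subsetI)
  fix j assume "j \<in> B"
  then show "j \<in> (arcs P)\<^sup>* `` {Min B}"
  proof (induction j rule: less_induct)
    case (less j)
    show ?case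
    proof (cases "j = Min B")
      case False
      then obtain i where i: "i \<in> B" "(i, j) \<in> arcs P"
        using ex_arc_into[OF B _ less.prems False] finite_block[OF P B] by auto
      then have "i \<in> (arcs P)\<^sup>* `` {Min B}" using less.IH arcs_less by blast
      then show ?thesis using i by (auto intro: rtrancl_into_rtrancl)
    qed simp
  qed
next
  fix j assume "j \<in> (arcs P)\<^sup>* `` {Min B}"
  then have "(Min B, j) \<in> (arcs P)\<^sup>*" by simp
  then show "j \<in> B"
  proof (induction rule: rtrancl_induct)
    case base
    then show ?case using finite_block[OF P B] by simp
  next
    case (step i j)
    then show ?case using arcs_same_block[OF P(1) B step.hyps(2)] by simp
  qed
qed

lemma chain_partition_arcs:
  assumes "partition_on A P" "finite A"
  shows "chain_partition (arcs P) (Min ` P) = P"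
  using block_eq_chain[OF assms, symmetric] by (simp add: chain_partition_def image_image)

text \<open>
  An increasing relation that is single-valued in both directions is a disjoint union of increasing
  chains. Consecutive elements of a chain are exactly the related pairs, so the relation is recovered
  as the set of arcs; chains start outside the range and end outside the domain.
\<close>

lemma chain_partition_correct:
  fixes E :: "(nat \<times> nat) set"
  assumes less: "\<And>i j. (i, j) \<in> E \<Longrightarrow> i < j"
    and sv: "single_valued E" "single_valued (E\<inverse>)"
    and dom: "Domain E = A - T" and ran: "Range E = A - S"
    and A: "finite A" "S \<subseteq> A" "T \<subseteq> A"
  defines "P \<equiv> chain_partition E S"
  shows "partition_on A P" "Min ` P = S" "Max ` P = T" "arcs P = E"
proof -
  have le: "i \<le> j" if "(i, j) \<in> E\<^sup>*" for i j
    using that by (induction rule: rtrancl_induct) (auto dest: less)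
  have inA: "j \<in> A" if "(i, j) \<in> E\<^sup>*" "i \<in> A" for i j
    using that ran by (induction rule: rtrancl_induct) auto
  have root: "\<exists>s\<in>S. (s, j) \<in> E\<^sup>*" if "j \<in> A" for j
    using that
  proof (induction j rule: less_induct)
    case (less j)
    show ?case
    proof (cases "j \<in> S")
      case False
      then have "j \<in> Range E" using less.prems ran by simp
      then obtain i where i: "(i, j) \<in> E" by auto
      moreover have "i \<in> A" using i dom by auto
      ultimately show ?thesis using less.IH[of i] assms(1) by (auto intro: rtrancl_into_rtrancl)
    qed auto
  qed
  have Smin: "i = s" if "(i, s) \<in> E\<^sup>*" "s \<in> S" for i s
    using that ran by (auto elim: rtranclE)
  have Tmax: "j = t" if "(t, j) \<in> E\<^sup>*" "t \<in> T" for j t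
    using that dom by (auto elim: converse_rtranclE)
  have conv: "(i, j) \<in> E\<^sup>* \<Longrightarrow> (k, j) \<in> E\<^sup>* \<Longrightarrow> (i, k) \<in> E\<^sup>* \<or> (k, i) \<in> E\<^sup>*" for i j k
    using single_valued_confluent[OF sv(2), of j i k] by (auto simp: rtrancl_converse)
  have uniq: "s = s'" if "s \<in> S" "s' \<in> S" "(s, j) \<in> E\<^sup>*" "(s', j) \<in> E\<^sup>*" for s s' j
    using conv[OF that(3,4)] Smin that by blast
  have fin: "finite (E\<^sup>* `` {s})" if "s \<in> S" for s
    using that A inA by (intro finite_subset[OF _ A(1)]) auto
  show part: "partition_on A P"
  proof (rule partition_onI)
    show "{} \<notin> P" by (auto simp: P_def chain_partition_def)
    show "\<Union>P = A" using root inA A by (auto simp: P_def chain_partition_def)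
    show "disjnt p q" if "p \<in> P" "q \<in> P" "p \<noteq> q" for p q
      using that uniq by (auto simp: P_def chain_partition_def disjnt_iff)
  qed
  have "Min (E\<^sup>* `` {s}) = s" if "s \<in> S" for s
    using fin[OF that] le by (intro Min_eqI) auto
  then show "Min ` P = S" by (auto simp: P_def chain_partition_def image_image)
  show "Max ` P = T"
  proof (intro equalityI subsetI)
    fix t assume "t \<in> Max ` P"
    then obtain s where s: "s \<in> S" "t = Max (E\<^sup>* `` {s})" by (auto simp: P_def chain_partition_def)
    then have st: "(s, t) \<in> E\<^sup>*" using Max_in[OF fin[OF s(1)]] by blast
    have "t \<notin> Domain E"
    proof
      assume "t \<in> Domain E"
      then obtain j where j: "(t, j) \<in> E" by auto
      then have "j \<in> E\<^sup>* `` {s}" using st by (auto intro: rtrancl_into_rtrancl)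
      then show False using Max_ge[OF fin[OF s(1)], of j] s less[OF j] by simp
    qed
    then show "t \<in> T" using dom inA[OF st] s A by blast
  next
    fix t assume t: "t \<in> T"
    then obtain s where s: "s \<in> S" "(s, t) \<in> E\<^sup>*" using root A by blast
    have "j \<le> t" if "(s, j) \<in> E\<^sup>*" for j
      using single_valued_confluent[OF sv(1) s(2) that] le Tmax[OF _ t] by blast
    then have "Max (E\<^sup>* `` {s}) = t" using s fin by (intro Max_eqI) auto
    then show "t \<in> Max ` P" using s by (auto simp: P_def chain_partition_def)
  qed
  show "arcs P = E"
  proof (intro equalityI subrelI)
    fix i j assume "(i, j) \<in> arcs P"
    then obtain s where s: "s \<in> S" "(s, i) \<in> E\<^sup>*" "(s, j) \<in> E\<^sup>*" "i < j"
      and nb: "\<And>k. (s, k) \<in> E\<^sup>* \<Longrightarrow> i < k \<Longrightarrow> j \<le> k"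
      by (auto simp: arcs_def P_def chain_partition_def not_less[symmetric])
    have "(i, j) \<in> E\<^sup>*" using single_valued_confluent[OF sv(1) s(2,3)] le[of j i] s(4) by auto
    then obtain k where k: "(i, k) \<in> E" "(k, j) \<in> E\<^sup>*"
      using s(4) by (auto elim: converse_rtranclE)
    then have "j \<le> k" using nb[of k] s(2) less by (meson rtrancl_into_rtrancl)
    then show "(i, j) \<in> E" using k le[of k j] by simp
  next
    fix i j assume ij: "(i, j) \<in> E"
    then have "i \<in> A" using dom by auto
    then obtain s where s: "s \<in> S" "(s, i) \<in> E\<^sup>*" using root by blast
    show "(i, j) \<in> arcs P"
    proof (rule arcsI)
      show "E\<^sup>* `` {s} \<in> P" using s by (auto simp: P_def chain_partition_def)
      show "i \<in> E\<^sup>* `` {s}" "j \<in> E\<^sup>* `` {s}" using s ij by (auto intro: rtrancl_into_rtrancl)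
      show "i < j" using less[OF ij] .
      fix k assume k: "k \<in> E\<^sup>* `` {s}" "i < k"
      then have "(i, k) \<in> E\<^sup>*" using single_valued_confluent[OF sv(1) s(2)] le[of k i] by fastforce
      then obtain j' where "(i, j') \<in> E" "(j', k) \<in> E\<^sup>*"
        using k(2) by (auto elim: converse_rtranclE)
      then show "j \<le> k" using sv(1) ij le by (auto dest: single_valuedD)
    qed
  qed
qed

lemma set_zip_single_valued:
  assumes "distinct xs" "distinct ys" "length xs = length ys"
  shows "single_valued (set (zip xs ys))" "single_valued ((set (zip xs ys))\<inverse>)"
  using assms by (auto simp: single_valued_def set_zip nth_eq_iff_index_eq)

lemma zip_inject_left:
  assumes "distinct ys" "length xs = length ys" "length xs' = length ys"
    and "set (zip xs ys) = set (zip xs' ys)"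
  shows "xs = xs'"
proof (rule nth_equalityI)
  show "length xs = length xs'" using assms by simp
  fix i assume i: "i < length xs"
  then have "(xs ! i, ys ! i) \<in> set (zip xs ys)" using assms(1-3) by (auto simp: in_set_zip)
  then have "(xs ! i, ys ! i) \<in> set (zip xs' ys)" using assms by simp
  then obtain i' where "xs' ! i' = xs ! i" "ys ! i' = ys ! i" "i' < length ys"
    unfolding in_set_zip by auto
  then show "xs ! i = xs' ! i" using i assms by (simp add: nth_eq_iff_index_eq)
qed

lemma partitions_arc_words_bij:
  assumes S: "S \<subseteq> {1..n}" and T: "T \<subseteq> {1..n}"
    and ls: "set ls = {1..n} - T" and rs: "distinct rs" "set rs = {1..n} - S"
  defines "F \<equiv> \<lambda>x. chain_partition (set (zip x rs)) S"
  shows "bij_betw F (arc_words ls rs) (partitions_min_max n S T)"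
    and "\<And>x. x \<in> arc_words ls rs \<Longrightarrow> arcs (F x) = set (zip x rs)"
proof -
  have *: "partition_on {1..n} (F x) \<and> Min ` F x = S \<and> Max ` F x = T \<and> arcs (F x) = set (zip x rs)"
    if x: "x \<in> arc_words ls rs" for x
  proof -
    have len: "length x = length rs" and d: "distinct x" and sx: "set x = set ls"
      and lt: "\<And>i. i < length rs \<Longrightarrow> x ! i < rs ! i"
      using x by (auto simp: arc_words_def)
    have D: "Domain (set (zip x rs)) = {1..n} - T"
      by (metis Domain_fst ls sx len map_fst_zip set_map)
    have R: "Range (set (zip x rs)) = {1..n} - S"
      by (metis Range_snd rs(2) len map_snd_zip set_map)
    have L: "\<And>i j. (i, j) \<in> set (zip x rs) \<Longrightarrow> i < j" using lt by (auto simp: set_zip)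
    show ?thesis unfolding F_def
      using chain_partition_correct[OF L set_zip_single_valued[OF d rs(1) len] D R _ S T] by simp
  qed
  then show "\<And>x. x \<in> arc_words ls rs \<Longrightarrow> arcs (F x) = set (zip x rs)" by blast
  show "bij_betw F (arc_words ls rs) (partitions_min_max n S T)"
  proof (rule bij_betw_imageI)
    show "inj_on F (arc_words ls rs)"
    proof (rule inj_onI)
      fix x x' assume "x \<in> arc_words ls rs" "x' \<in> arc_words ls rs" "F x = F x'"
      moreover from this have "set (zip x rs) = set (zip x' rs)" using * by metis
      ultimately show "x = x'"
        by (intro zip_inject_left[OF rs(1)]) (simp_all add: arc_words_def)
    qed
    show "F ` arc_words ls rs = partitions_min_max n S T"
    proof (intro equalityI subsetI)
      fix P assume "P \<in> F ` arc_words ls rs"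
      then obtain x where "x \<in> arc_words ls rs" "P = F x" by blast
      then show "P \<in> partitions_min_max n S T" using *[of x] by (simp add: partitions_min_max_def)
    next
      fix P assume "P \<in> partitions_min_max n S T"
      then have P: "partition_on {1..n} P" and mm: "Min ` P = S" "Max ` P = T"
        by (auto simp: partitions_min_max_def)
      note sv = single_valued_arcs[OF P]
      have D: "Domain (arcs P) = set ls" and R: "Range (arcs P) = set rs"
        using Domain_Range_arcs[OF P] mm ls rs by auto
      define f where "f r = (THE l. (l, r) \<in> arcs P)" for r
      have f: "(f r, r) \<in> arcs P" if "r \<in> set rs" for r
      proof -
        from that obtain l where "(l, r) \<in> arcs P" using R by blast
        then show ?thesis unfolding f_def
          by (rule theI) (use sv(2) \<open>(l, r) \<in> arcs P\<close> in \<open>auto simp: single_valued_def\<close>)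
      qed
      have eq: "set (zip (map f rs) rs) = arcs P"
      proof (intro equalityI subrelI)
        fix l r assume "(l, r) \<in> set (zip (map f rs) rs)"
        then show "(l, r) \<in> arcs P" using f by (auto simp: set_zip)
      next
        fix l r assume a: "(l, r) \<in> arcs P"
        then have r: "r \<in> set rs" using R by auto
        then have "l = f r" using f[OF r] a sv(2) by (auto simp: single_valued_def)
        then show "(l, r) \<in> set (zip (map f rs) rs)" using r by (force simp: set_zip in_set_conv_nth)
      qed
      have "inj_on f (set rs)"
        using f sv(1) by (intro inj_onI) (metis single_valuedD)
      moreover have "f ` set rs = set ls"
        unfolding D[symmetric] eq[symmetric] Domain_fst by (simp flip: set_map)
      ultimately have "map f rs \<in> arc_words ls rs"
        using arcs_less[OF f] rs(1) by (auto simp: arc_words_def distinct_map)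
      moreover have "F (map f rs) = P"
        unfolding F_def eq using chain_partition_arcs[OF P] mm by simp
      ultimately show "P \<in> F ` arc_words ls rs" by blast
    qed
  qed
qed

section \<open>Reading the statistics off the word\<close>

text \<open>
  As \<open>rs\<close> decreases, the arc with the larger right endpoint \<open>j2\<close> is the one at the smaller position \<open>q\<close>.
\<close>

lemma cr2_eq_word_cr:
  assumes arcs: "arcs P = set (zip x rs)" and len: "length x = length rs"
    and rs: "sorted_wrt (>) rs" and d: "distinct x"
  shows "cr2 P = word_cr rs x"
proof -
  let ?k = "length rs"
  let ?Q = "SIGMA p:{..<?k}. {q. q < p \<and> x ! p < x ! q \<and> x ! q < rs ! p}"
  let ?h = "\<lambda>(p, q). ((x ! p, rs ! p), (x ! q, rs ! q))"
  have desc: "rs ! p < rs ! q \<longleftrightarrow> q < p" if "p < ?k" "q < ?k" for p q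
    using sorted_wrt_nth_less[OF rs, of p q] sorted_wrt_nth_less[OF rs, of q p] that
    by (cases p q rule: linorder_cases) auto
  have "{((i1, j1), (i2, j2)). (i1, j1) \<in> arcs P \<and> (i2, j2) \<in> arcs P \<and> i1 < i2 \<and> i2 < j1 \<and> j1 < j2}
    = ?h ` ?Q"
    unfolding arcs using len desc by (fastforce simp: set_zip image_iff)
  moreover have "inj_on ?h ?Q"
    using d len by (auto simp: inj_on_def nth_eq_iff_index_eq)
  ultimately have "cr2 P = card ?Q" unfolding cr2_def by (simp add: card_image)
  also have "\<dots> = (\<Sum>p<?k. card {q. q < p \<and> x ! p < x ! q \<and> x ! q < rs ! p})"
    by (subst card_SigmaI) auto
  also have "\<dots> = word_cr rs x"
    unfolding word_cr_def len
  proof (rule sum.cong[OF refl])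
    fix p assume "p \<in> {..<?k}"
    then show "card {q. q < p \<and> x ! p < x ! q \<and> x ! q < rs ! p} =
        length (filter (\<lambda>l. x ! p < l \<and> l < rs ! p) (take p x))"
      using len by (auto simp: length_filter_conv_card intro!: arg_cong[of _ _ card])
  qed
  finally show ?thesis .
qed

text \<open>
  Reversing a word turns descents into ascents, and an order-reversing relabelling turns them back.
  This reconciles the words of labels in the definition of \<open>pmaj\<close>, which grow at the front and whose
  labels decrease with the left endpoint, with the prefixes of the word of left endpoints.
\<close>

lemma des_rev_map_antimono:
  assumes "\<And>a b. a \<in> set w \<Longrightarrow> b \<in> set w \<Longrightarrow> f a < f b \<longleftrightarrow> b < a"
  shows "des (rev (map f w)) = des w"
  unfolding des_def
proof (rule bij_betw_same_card)
  let ?g = "\<lambda>i. length w - 2 - i"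
  have idx: "rev (map f w) ! i = f (w ! (length w - Suc i))" if "i < length w" for i
    using that by (simp add: rev_nth)
  show "bij_betw ?g {i. Suc i < length (rev (map f w)) \<and> rev (map f w) ! Suc i < rev (map f w) ! i}
      {i. Suc i < length w \<and> w ! Suc i < w ! i}"
  proof (rule bij_betw_byWitness[where f' = ?g])
    have aux: "length w - Suc i = Suc (length w - Suc (Suc i))"
        "length w - 2 - i = length w - Suc (Suc i)" if "Suc i < length w" for i
      using that by auto
    show "?g ` {i. Suc i < length (rev (map f w)) \<and> rev (map f w) ! Suc i < rev (map f w) ! i}
       \<subseteq> {i. Suc i < length w \<and> w ! Suc i < w ! i}"
      using assms by (auto simp: idx aux)
    show "?g ` {i. Suc i < length w \<and> w ! Suc i < w ! i}
       \<subseteq> {i. Suc i < length (rev (map f w)) \<and> rev (map f w) ! Suc i < rev (map f w) ! i}"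
    proof clarify
      fix i assume i: "Suc i < length w" "w ! Suc i < w ! i"
      then have "length w - Suc (?g i) = Suc i" "length w - Suc (Suc (?g i)) = i" by auto
      then show "Suc (?g i) < length (rev (map f w)) \<and> rev (map f w) ! Suc (?g i) < rev (map f w) ! ?g i"
        using i assms by (simp add: idx)
    qed
  qed auto
qed

text \<open>
  The letters deleted on the way from \<open>rs ! i\<close> to \<open>rs ! Suc i\<close> are those with left endpoint in between,
  so what remains in the word of \<open>rs ! i\<close> are the arcs that start before \<open>rs ! i\<close> and end at or after it.
\<close>

lemma pmaj_eq_word_pmaj:
  assumes arcs: "arcs P = set (zip x rs)" and len: "length x = length rs"
    and rs: "sorted_wrt (>) rs" and d: "distinct x" and lt: "\<And>i. i < length rs \<Longrightarrow> x ! i < rs ! i"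
  shows "pmaj P = word_pmaj rs x"
proof -
  let ?k = "length rs"
  define ls where "ls = rev (sorted_list_of_set (set x))"
  have asc: "sorted_wrt (<) (rev rs)" using rs by (simp add: sorted_wrt_rev)
  then have drs: "distinct rs" by (simp add: strict_sorted_iff)
  have lls: "length ls = ?k" "set ls = set x" "distinct ls" "sorted_wrt (>) ls"
    using d len by (auto simp: ls_def distinct_card sorted_wrt_rev)
  have le: "left_end P a = ls ! (a - 1)" for a
    unfolding left_end_def arcs ls_def using len by (metis map_fst_zip set_map)
  have "sorted_list_of_set (set (rev rs)) = rev rs"
    using asc by (intro sorted_list_of_set.idem_if_sorted_distinct) (auto simp: strict_sorted_iff)
  then have "rev (sorted_list_of_set (set rs)) = rs" by simp
  then have re: "right_end P (Suc i) = rs ! i" for i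
    unfolding right_end_def arcs using len by (metis map_snd_zip set_map diff_Suc_1)
  have card: "card (arcs P) = ?k"
    unfolding arcs using len d drs by (simp add: distinct_card distinct_zipI1)
  define lab where "lab l = (THE a. a \<in> {1..?k} \<and> ls ! (a - 1) = l)" for l
  have lab_nth: "lab (ls ! b) = Suc b" if "b < ?k" for b
    unfolding lab_def
  proof (rule the_equality)
    fix a assume "a \<in> {1..?k} \<and> ls ! (a - 1) = ls ! b"
    then show "a = Suc b" using that lls by (auto simp: nth_eq_iff_index_eq)
  qed (use that in auto)
  have ls_index: "\<exists>b<?k. ls ! b = l" if "l \<in> set x" for l
    using that unfolding lls(1,2)[symmetric] by (simp add: in_set_conv_nth)
  have ls_lab: "ls ! (lab l - 1) = l" if "l \<in> set x" for l
    using ls_index[OF that] lab_nth by auto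
  have lab_anti: "lab l < lab l' \<longleftrightarrow> l' < l" if l: "l \<in> set x" "l' \<in> set x" for l l'
  proof -
    obtain b b' where "b < ?k" "ls ! b = l" "b' < ?k" "ls ! b' = l'"
      using ls_index[OF l(1)] ls_index[OF l(2)] by blast
    then show ?thesis
      using sorted_wrt_nth_less[OF lls(4), of b b'] sorted_wrt_nth_less[OF lls(4), of b' b] lls(1)
      by (cases b b' rule: linorder_cases) (auto simp: lab_nth)
  qed
  have label: "label_at P (rs ! i) = lab (x ! i)" if i: "i < ?k" for i
  proof -
    have "(l, rs ! i) \<in> arcs P \<longleftrightarrow> l = x ! i" for l
      unfolding arcs using i len drs by (auto simp: set_zip nth_eq_iff_index_eq)
    then show ?thesis unfolding label_at_def lab_def card le by simp
  qed
  have sigma: "sigma P (Suc i) = rev (map lab (filter (\<lambda>l. l < rs ! i) (take (Suc i) x)))"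
    if "i < ?k" for i
    using that
  proof (induction i)
    case 0
    then have "take (Suc 0) x = [x ! 0]" using len by (cases x) auto
    then show ?case using 0 lt[of 0] by (simp add: re[of 0, simplified] label)
  next
    case (Suc i)
    have tk: "take (Suc (Suc i)) x = take (Suc i) x @ [x ! Suc i]"
      using Suc.prems len by (simp add: take_Suc_conv_app_nth)
    have r: "rs ! Suc i < rs ! i" using sorted_wrt_nth_less[OF rs, of i "Suc i"] Suc.prems by simp
    have "filter (\<lambda>a. \<not> (rs ! Suc i \<le> ls ! (a - 1) \<and> ls ! (a - 1) < rs ! i))
        (map lab (filter (\<lambda>l. l < rs ! i) (take (Suc i) x))) =
      map lab (filter (\<lambda>l. l < rs ! Suc i) (take (Suc i) x))"
      unfolding filter_map filter_filter comp_def
      using r ls_lab by (intro arg_cong[of _ _ "map lab"] filter_cong refl) (auto dest!: in_set_takeD)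
    then show ?case
      using Suc lt[of "Suc i"] by (simp add: tk re label le rev_filter[symmetric])
  qed
  have "pmaj P = (\<Sum>i<?k. des (sigma P (Suc i)))"
    unfolding pmaj_def card
    by (rule sum.reindex_bij_witness[of _ Suc "\<lambda>i. i - 1"]) auto
  also have "\<dots> = word_pmaj rs x"
    unfolding word_pmaj_def len
  proof (rule sum.cong[OF refl])
    fix i assume "i \<in> {..<?k}"
    then show "des (sigma P (Suc i)) = des (filter (\<lambda>l. l < rs ! i) (take (Suc i) x))"
      using lab_anti by (simp only: sigma lessThan_iff) (rule des_rev_map_antimono, auto dest: in_set_takeD)
  qed
  finally show ?thesis .
qed

theorem corollary3:
  fixes n :: nat and S T :: "nat set"
  assumes "n \<ge> 1" and "S \<subseteq> {1..n}" and "T \<subseteq> {1..n}" and "card S = card T"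
  shows "(\<Sum>P\<in>partitions_min_max n S T. monom (1::int) (pmaj P)) =
         (\<Sum>P\<in>partitions_min_max n S T. monom (1::int) (cr2 P))"
proof -
  define ls where "ls = rev (sorted_list_of_set ({1..n} - T))"
  define rs where "rs = rev (sorted_list_of_set ({1..n} - S))"
  have ls: "set ls = {1..n} - T" "sorted_wrt (>) ls"
    and rs: "distinct rs" "set rs = {1..n} - S" "sorted_wrt (>) rs"
    by (auto simp: ls_def rs_def sorted_wrt_rev)
  have "length ls = length rs"
    using assms by (simp add: ls_def rs_def card_Diff_subset finite_subset)
  note words = sum_word_pmaj_eq_sum_word_cr[OF ls(2) rs(3) this, of "monom (1::int) 1"]
  note bij = partitions_arc_words_bij[OF assms(2,3) ls(1) rs(1,2)]
  let ?F = "\<lambda>x. chain_partition (set (zip x rs)) S"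
  have "pmaj (?F x) = word_pmaj rs x" "cr2 (?F x) = word_cr rs x" if "x \<in> arc_words ls rs" for x
    using that by (auto simp: arc_words_def
        intro!: pmaj_eq_word_pmaj[OF bij(2)[OF that]] cr2_eq_word_cr[OF bij(2)[OF that]] rs(3))
  then show ?thesis
    using words by (simp add: monom_power flip: sum.reindex_bij_betw[OF bij(1)])
qed

end
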